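(* Let $F=ap^2+2bpq+cq^2$ and $F'=a'p^2+2b'pq+c'q^2$ be real binary quadratic forms, and write $F=Xf_1+Yf_2+Zf_3$, $F'=X'f_1+Y'f_2+Z'f_3$ with $f_1=2pq$, $f_2=p^2-q^2$, $f_3=p^2+q^2$. Define the scalar product of $F$ and $F'$ as $-\tilde\Delta(F,F')$, where $\tilde\Delta(F,F')=\frac{ac'+ca'}{2}-bb'$ is the symmetric bilinear form coinciding on the diagonal with the discriminant $\Delta=ac-b^2$. Then, in the coordinates $(X,Y,Z)$, the scalar product of $F=(X,Y,Z)$ with $F'=(X',Y',Z')$ coincides with the scalar product $XX'+YY'-ZZ'$ of $\mathbb{R}^3_H$, and the square norm of $F$ coincides with $X^2+Y^2-Z^2$.
   Context: $\mathbb{R}^3_H$ is $\mathbb{R}^3$ with the pseudo-Euclidean scalar product $(x,y,z)\,\bar\cdot\,(x',y',z')=xx'+yy'-zz'$ and square norm $x^2+y^2-z^2$. The square norm of a form $F$ is its scalar product with itself. *)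

theory Defs
  imports "HOL-Analysis.Analysis"
begin

text \<open>Real binary quadratic forms as polynomial functions of \<open>(p, q)\<close>. Over the reals such a
  function determines its coefficients (lemma \<open>bqf_eq_iff\<close> below).\<close>

typedef bqform = "{F :: real \<Rightarrow> real \<Rightarrow> real. \<exists>a b c. F = (\<lambda>p q. a * p\<^sup>2 + 2 * b * p * q + c * q\<^sup>2)}"
  morphisms eval_bqf Abs_bqform
  by blast

setup_lifting type_definition_bqform

lift_definition bqf :: "real \<Rightarrow> real \<Rightarrow> real \<Rightarrow> bqform"
  is "\<lambda>a b c p q. a * p\<^sup>2 + 2 * b * p * q + c * q\<^sup>2"
  by blast

instantiation bqform :: real_vector
begin

lift_definition zero_bqform :: bqform is "\<lambda>p q. 0"
  by (rule exI[of _ 0], rule exI[of _ 0], rule exI[of _ 0]) simp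

lift_definition plus_bqform :: "bqform \<Rightarrow> bqform \<Rightarrow> bqform" is "\<lambda>F G p q. F p q + G p q"
proof -
  fix F G :: "real \<Rightarrow> real \<Rightarrow> real"
  assume "\<exists>a b c. F = (\<lambda>p q. a * p\<^sup>2 + 2 * b * p * q + c * q\<^sup>2)"
    and "\<exists>a b c. G = (\<lambda>p q. a * p\<^sup>2 + 2 * b * p * q + c * q\<^sup>2)"
  then obtain a b c a' b' c' where "F = (\<lambda>p q. a * p\<^sup>2 + 2 * b * p * q + c * q\<^sup>2)"
    "G = (\<lambda>p q. a' * p\<^sup>2 + 2 * b' * p * q + c' * q\<^sup>2)" by blast
  then have "(\<lambda>p q. F p q + G p q) =
      (\<lambda>p q. (a + a') * p\<^sup>2 + 2 * (b + b') * p * q + (c + c') * q\<^sup>2)"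
    by (simp add: algebra_simps)
  then show "\<exists>a b c. (\<lambda>p q. F p q + G p q) = (\<lambda>p q. a * p\<^sup>2 + 2 * b * p * q + c * q\<^sup>2)"
    by blast
qed

lift_definition scaleR_bqform :: "real \<Rightarrow> bqform \<Rightarrow> bqform" is "\<lambda>r F p q. r * F p q"
proof -
  fix r :: real and F :: "real \<Rightarrow> real \<Rightarrow> real"
  assume "\<exists>a b c. F = (\<lambda>p q. a * p\<^sup>2 + 2 * b * p * q + c * q\<^sup>2)"
  then obtain a b c where "F = (\<lambda>p q. a * p\<^sup>2 + 2 * b * p * q + c * q\<^sup>2)" by blast
  then have "(\<lambda>p q. r * F p q) =
      (\<lambda>p q. (r * a) * p\<^sup>2 + 2 * (r * b) * p * q + (r * c) * q\<^sup>2)"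
    by (simp add: algebra_simps)
  then show "\<exists>a b c. (\<lambda>p q. r * F p q) = (\<lambda>p q. a * p\<^sup>2 + 2 * b * p * q + c * q\<^sup>2)"
    by blast
qed

definition uminus_bqform :: "bqform \<Rightarrow> bqform" where
  "uminus_bqform F = (- 1) *\<^sub>R F"

definition minus_bqform :: "bqform \<Rightarrow> bqform \<Rightarrow> bqform" where
  "minus_bqform F G = F + (- G)"

instance
  by standard
    (unfold uminus_bqform_def minus_bqform_def, (transfer, simp add: fun_eq_iff algebra_simps)+)

end

lemma bqf_eq_iff: "bqf a b c = bqf a' b' c' \<longleftrightarrow> a = a' \<and> b = b' \<and> c = c'"
proof
  assume "bqf a b c = bqf a' b' c'"
  then have ev: "a * p\<^sup>2 + 2 * b * p * q + c * q\<^sup>2 = a' * p\<^sup>2 + 2 * b' * p * q + c' * q\<^sup>2" for p q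
    by transfer (simp add: fun_eq_iff)
  show "a = a' \<and> b = b' \<and> c = c'"
    using ev[of 1 0] ev[of 0 1] ev[of 1 1] by simp
qed simp

lemma bqf_cases: obtains a b c where "F = bqf a b c"
proof -
  have "\<exists>a b c. F = bqf a b c" by transfer simp
  then show ?thesis using that by blast
qed

definition coef_a :: "bqform \<Rightarrow> real" where
  "coef_a F = (THE a. \<exists>b c. F = bqf a b c)"

definition coef_b :: "bqform \<Rightarrow> real" where
  "coef_b F = (THE b. \<exists>a c. F = bqf a b c)"

definition coef_c :: "bqform \<Rightarrow> real" where
  "coef_c F = (THE c. \<exists>a b. F = bqf a b c)"

lemma coef_bqf [simp]: "coef_a (bqf a b c) = a" "coef_b (bqf a b c) = b" "coef_c (bqf a b c) = c"
  by (auto simp: coef_a_def coef_b_def coef_c_def bqf_eq_iff)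

lift_definition f1 :: bqform is "\<lambda>p q. 2 * p * q"
  by (rule exI[of _ 0], rule exI[of _ 1], rule exI[of _ 0]) simp

lift_definition f2 :: bqform is "\<lambda>p q. p\<^sup>2 - q\<^sup>2"
  by (rule exI[of _ 1], rule exI[of _ 0], rule exI[of _ "-1"]) simp

lift_definition f3 :: bqform is "\<lambda>p q. p\<^sup>2 + q\<^sup>2"
  by (rule exI[of _ 1], rule exI[of _ 0], rule exI[of _ 1]) simp

definition discr :: "bqform \<Rightarrow> real" where
  "discr F = coef_a F * coef_c F - (coef_b F)\<^sup>2"

definition discr_polar :: "bqform \<Rightarrow> bqform \<Rightarrow> real" where
  "discr_polar F F' = (coef_a F * coef_c F' + coef_c F * coef_a F') / 2 - coef_b F * coef_b F'"

definition form_prod :: "bqform \<Rightarrow> bqform \<Rightarrow> real" where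
  "form_prod F F' = - discr_polar F F'"

definition form_sqnorm :: "bqform \<Rightarrow> real" where
  "form_sqnorm F = form_prod F F"

text \<open>The pseudo-Euclidean structure of $\mathbb{R}^3_H$ on the type \<open>real ^ 3\<close>.\<close>

definition hyp_prod :: "real ^ 3 \<Rightarrow> real ^ 3 \<Rightarrow> real" where
  "hyp_prod v w = v $ 1 * w $ 1 + v $ 2 * w $ 2 - v $ 3 * w $ 3"

definition hyp_sqnorm :: "real ^ 3 \<Rightarrow> real" where
  "hyp_sqnorm v = (v $ 1)\<^sup>2 + (v $ 2)\<^sup>2 - (v $ 3)\<^sup>2"

lemma comb_f_eq_bqf: "X *\<^sub>R f1 + Y *\<^sub>R f2 + Z *\<^sub>R f3 = bqf (Y + Z) X (Z - Y)"
  by transfer (simp add: fun_eq_iff algebra_simps)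

text \<open>Every form has unique coordinates with respect to \<open>f1, f2, f3\<close>.\<close>

lemma ex1_coordinates: "\<exists>!v :: real ^ 3. F = v $ 1 *\<^sub>R f1 + v $ 2 *\<^sub>R f2 + v $ 3 *\<^sub>R f3"
proof -
  obtain a b c where F: "F = bqf a b c" by (rule bqf_cases)
  show ?thesis
  proof (rule ex1I)
    let ?v = "vector [b, (a - c) / 2, (a + c) / 2] :: real ^ 3"
    show "F = ?v $ 1 *\<^sub>R f1 + ?v $ 2 *\<^sub>R f2 + ?v $ 3 *\<^sub>R f3"
      unfolding F comb_f_eq_bqf bqf_eq_iff by (simp add: field_simps)
  next
    fix v :: "real ^ 3"
    assume "F = v $ 1 *\<^sub>R f1 + v $ 2 *\<^sub>R f2 + v $ 3 *\<^sub>R f3"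
    then show "v = vector [b, (a - c) / 2, (a + c) / 2]"
      unfolding F comb_f_eq_bqf bqf_eq_iff by (auto simp: vec_eq_iff forall_3)
  qed
qed

end

theory Submission
  imports Defs
begin

text \<open>Passing from \<open>(X, Y, Z)\<close> to the coefficients is the substitution \<open>a = Y + Z\<close>, \<open>b = X\<close>,
  \<open>c = Z - Y\<close>, which diagonalises the discriminant:
  \<open>b\<^sup>2 - a c = X\<^sup>2 - (Z + Y) (Z - Y) = X\<^sup>2 + Y\<^sup>2 - Z\<^sup>2\<close>. The scalar products on the two sides are the
  polarisations of these equal quadratic forms, hence equal as well; with the coordinates at hand
  this is an identity of polynomials.

  That \<open>discr_polar\<close> is the only symmetric bilinear form with diagonal \<open>discr\<close> is the polarisation
  identity, which recovers such a form from its diagonal because 2 is invertible in the reals.\<close>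

lemma bqf_add: "bqf a b c + bqf a' b' c' = bqf (a + a') (b + b') (c + c')"
  by transfer (simp add: fun_eq_iff algebra_simps)

lemma bqf_scaleR: "r *\<^sub>R bqf a b c = bqf (r * a) (r * b) (r * c)"
  by transfer (simp add: fun_eq_iff algebra_simps)

lemma linear_coef: "linear coef_a" "linear coef_b" "linear coef_c"
proof -
  have add: "coef_a (G + H) = coef_a G + coef_a H" "coef_b (G + H) = coef_b G + coef_b H"
    "coef_c (G + H) = coef_c G + coef_c H" for G H
    by (cases G rule: bqf_cases; cases H rule: bqf_cases; simp add: bqf_add)+
  have scaleR: "coef_a (r *\<^sub>R G) = r *\<^sub>R coef_a G" "coef_b (r *\<^sub>R G) = r *\<^sub>R coef_b G"
    "coef_c (r *\<^sub>R G) = r *\<^sub>R coef_c G" for r G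
    by (cases G rule: bqf_cases; simp add: bqf_scaleR)+
  show "linear coef_a" "linear coef_b" "linear coef_c"
    by (simp_all add: linear_iff add scaleR)
qed

lemma discr_polar_commute: "discr_polar G H = discr_polar H G"
  by (simp add: discr_polar_def algebra_simps)

lemma discr_polar_self: "discr_polar G G = discr G"
  by (simp add: discr_polar_def discr_def power2_eq_square algebra_simps)

lemma bilinear_discr_polar: "bilinear discr_polar"
  unfolding bilinear_def linear_iff discr_polar_def
  by (simp add: linear_add[OF linear_coef(1)] linear_add[OF linear_coef(2)]
      linear_add[OF linear_coef(3)] linear_scale[OF linear_coef(1)]
      linear_scale[OF linear_coef(2)] linear_scale[OF linear_coef(3)] field_simps)

text \<open>Expanding \<open>B (x + y) (x + y)\<close> produces the cross term \<open>B x y\<close> twice, by symmetry.\<close>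

lemma symmetric_bilinear_polarization:
  fixes B :: "'a::real_vector \<Rightarrow> 'a \<Rightarrow> real"
  assumes "bilinear B" and "\<And>x y. B x y = B y x"
  shows "B x y = (B (x + y) (x + y) - B x x - B y y) / 2"
  using assms(2)[of y x] by (simp add: bilinear_ladd[OF assms(1)] bilinear_radd[OF assms(1)])

lemma symmetric_bilinear_eqI:
  fixes B C :: "'a::real_vector \<Rightarrow> 'a \<Rightarrow> real"
  assumes "bilinear B" "\<And>x y. B x y = B y x" and "bilinear C" "\<And>x y. C x y = C y x"
    and "\<And>x. B x x = C x x"
  shows "B = C"
proof (intro ext)
  fix x y
  show "B x y = C x y"
    using symmetric_bilinear_polarization[OF assms(1,2), of x y]
      symmetric_bilinear_polarization[OF assms(3,4), of x y]
    by (simp only: assms(5))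
qed

lemma discr_polar_unique:
  "bilinear B \<and> (\<forall>G H. B G H = B H G) \<and> (\<forall>G. B G G = discr G) \<longleftrightarrow> B = discr_polar"
proof
  assume B: "bilinear B \<and> (\<forall>G H. B G H = B H G) \<and> (\<forall>G. B G G = discr G)"
  show "B = discr_polar"
  proof (rule symmetric_bilinear_eqI[OF _ _ bilinear_discr_polar discr_polar_commute])
    show "bilinear B" "B G H = B H G" "B G G = discr_polar G G" for G H
      using B by (simp_all add: discr_polar_self)
  qed
next
  assume "B = discr_polar"
  then show "bilinear B \<and> (\<forall>G H. B G H = B H G) \<and> (\<forall>G. B G G = discr G)"
    using bilinear_discr_polar discr_polar_commute discr_polar_self by blast
qed

lemma form_prod_coordinates:
  "form_prod (X *\<^sub>R f1 + Y *\<^sub>R f2 + Z *\<^sub>R f3) (X' *\<^sub>R f1 + Y' *\<^sub>R f2 + Z' *\<^sub>R f3)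
    = X * X' + Y * Y' - Z * Z'"
  unfolding comb_f_eq_bqf form_prod_def discr_polar_def coef_bqf by (simp add: field_simps)

theorem proposition2p5:
  fixes F F' :: bqform and a b c a' b' c' X Y Z X' Y' Z' :: real
  assumes "F = bqf a b c"
    and "F' = bqf a' b' c'"
    and "F = X *\<^sub>R f1 + Y *\<^sub>R f2 + Z *\<^sub>R f3"
    and "F' = X' *\<^sub>R f1 + Y' *\<^sub>R f2 + Z' *\<^sub>R f3"
  shows "(\<forall>B. bilinear B \<and> (\<forall>G H. B G H = B H G) \<and> (\<forall>G. B G G = discr G) \<longleftrightarrow> B = discr_polar)
    \<and> discr_polar F F' = (a * c' + c * a') / 2 - b * b'
    \<and> form_prod F F' = hyp_prod (vector [X, Y, Z]) (vector [X', Y', Z'])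
    \<and> form_prod F F' = X * X' + Y * Y' - Z * Z'
    \<and> form_sqnorm F = hyp_sqnorm (vector [X, Y, Z])
    \<and> form_sqnorm F = X\<^sup>2 + Y\<^sup>2 - Z\<^sup>2"
proof -
  have polar: "discr_polar F F' = (a * c' + c * a') / 2 - b * b'"
    by (simp add: assms(1,2) discr_polar_def)
  have prod: "form_prod F F' = X * X' + Y * Y' - Z * Z'"
    unfolding assms(3,4) by (rule form_prod_coordinates)
  have sqnorm: "form_sqnorm F = X\<^sup>2 + Y\<^sup>2 - Z\<^sup>2"
    unfolding assms(3) form_sqnorm_def form_prod_coordinates by (simp add: power2_eq_square)
  show ?thesis
  proof (intro conjI allI)
    show "form_prod F F' = hyp_prod (vector [X, Y, Z]) (vector [X', Y', Z'])"
      by (simp add: prod hyp_prod_def)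
    show "form_sqnorm F = hyp_sqnorm (vector [X, Y, Z])"
      by (simp add: sqnorm hyp_sqnorm_def)
  qed (rule discr_polar_unique polar prod sqnorm)+
qed

end
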